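(* Let $S$ be an inverse semigroup and let $\rho$ be a normal congruence on $E(S)$. Then $F_\rho\subset\widehat{E(S)}$ is a closed multiplicative invariant set.
   Context: An inverse semigroup is a semigroup $S$ in which every $s$ has a unique $s^*$ with $s=ss^*s$, $s^*=s^*ss^*$. $E(S)$ is the (commutative) semigroup of idempotents. A congruence on a semigroup is an equivalence relation compatible with left and right multiplication. A congruence $\rho$ on $E(S)$ is normal if $(e,f)\in\rho$ implies $(ses^*,sfs^* )\in\rho$ for all $s\in S$. For a commutative semigroup $E$ of idempotents, $\widehat{E}$ is the set of nonzero semigroup homomorphisms $E\to\{0,1\}$ (usual product on $\{0,1\}$) with the topology of pointwise convergence. For $s\in S$ and $\xi\in\widehat{E(S)}$ with $\xi(s^*s)=1$, $\beta_s(\xi)\in\widehat{E(S)}$ is defined by $\beta_s(\xi)(e)=\xi(s^*es)$. A subset $F\subset\widehat{E(S)}$ is invariant if $\beta_s(\xi)\in F$ whenever $s\in S$, $\xi\in F$ and $\xi(s^*s)=1$; multiplicative if the pointwise product of two elements of $F$ belongs to $F$ whenever it is not zero. With $q\colon E(S)\to E(S)/\rho$ the quotient map, $F_\rho=\{\eta\circ q:\eta\in\widehat{E(S)/\rho}\}\subset\widehat{E(S)}$. *)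

theory Defs
  imports "HOL-Analysis.Abstract_Topology" "HOL-Analysis.Product_Topology"
    "HOL-Analysis.Function_Topology"
begin

definition inverse_semigroup :: "'a set \<Rightarrow> ('a \<Rightarrow> 'a \<Rightarrow> 'a) \<Rightarrow> bool" where
  "inverse_semigroup S m \<longleftrightarrow>
     (\<forall>a\<in>S. \<forall>b\<in>S. m a b \<in> S) \<and>
     (\<forall>a\<in>S. \<forall>b\<in>S. \<forall>c\<in>S. m (m a b) c = m a (m b c)) \<and>
     (\<forall>s\<in>S. \<exists>!t. t \<in> S \<and> s = m (m s t) s \<and> t = m (m t s) t)"

definition star :: "'a set \<Rightarrow> ('a \<Rightarrow> 'a \<Rightarrow> 'a) \<Rightarrow> 'a \<Rightarrow> 'a" where
  "star S m s = (THE t. t \<in> S \<and> s = m (m s t) s \<and> t = m (m t s) t)"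

definition idempotents :: "'a set \<Rightarrow> ('a \<Rightarrow> 'a \<Rightarrow> 'a) \<Rightarrow> 'a set" where
  "idempotents S m = {e \<in> S. m e e = e}"

definition semigroup_congruence :: "'a set \<Rightarrow> ('a \<Rightarrow> 'a \<Rightarrow> 'a) \<Rightarrow> ('a \<times> 'a) set \<Rightarrow> bool" where
  "semigroup_congruence E m \<rho> \<longleftrightarrow>
     equiv E \<rho> \<and>
     (\<forall>e f g. (e, f) \<in> \<rho> \<longrightarrow> g \<in> E \<longrightarrow> (m g e, m g f) \<in> \<rho> \<and> (m e g, m f g) \<in> \<rho>)"

definition normal_congruence :: "'a set \<Rightarrow> ('a \<Rightarrow> 'a \<Rightarrow> 'a) \<Rightarrow> ('a \<times> 'a) set \<Rightarrow> bool" where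
  "normal_congruence S m \<rho> \<longleftrightarrow>
     semigroup_congruence (idempotents S m) m \<rho> \<and>
     (\<forall>s\<in>S. \<forall>e f. (e, f) \<in> \<rho> \<longrightarrow>
        (m (m s e) (star S m s), m (m s f) (star S m s)) \<in> \<rho>)"

text \<open>For a congruence the union below is a single class, that of the product of any
  representatives.\<close>

definition quotient_mult ::
    "('a \<Rightarrow> 'a \<Rightarrow> 'a) \<Rightarrow> ('a \<times> 'a) set \<Rightarrow> 'a set \<Rightarrow> 'a set \<Rightarrow> 'a set" where
  "quotient_mult m \<rho> A B = (\<Union>a\<in>A. \<Union>b\<in>B. \<rho> `` {m a b})"

text \<open>Functions with domain \<open>E\<close> are represented extensionally (\<open>undefined\<close> off \<open>E\<close>), so that
  equality of functions is equality on \<open>E\<close>; the values 0 and 1 are natural numbers.\<close>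

definition characters :: "'a set \<Rightarrow> ('a \<Rightarrow> 'a \<Rightarrow> 'a) \<Rightarrow> ('a \<Rightarrow> nat) set" where
  "characters E m = {\<xi> \<in> E \<rightarrow>\<^sub>E {0, 1}.
     (\<forall>e\<in>E. \<forall>f\<in>E. \<xi> (m e f) = \<xi> e * \<xi> f) \<and> (\<exists>e\<in>E. \<xi> e \<noteq> 0)}"

definition character_topology :: "'a set \<Rightarrow> ('a \<Rightarrow> 'a \<Rightarrow> 'a) \<Rightarrow> ('a \<Rightarrow> nat) topology" where
  "character_topology E m =
     subtopology (product_topology (\<lambda>_. discrete_topology {0, 1}) E) (characters E m)"

definition beta :: "'a set \<Rightarrow> ('a \<Rightarrow> 'a \<Rightarrow> 'a) \<Rightarrow> 'a \<Rightarrow> ('a \<Rightarrow> nat) \<Rightarrow> 'a \<Rightarrow> nat" where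
  "beta S m s \<xi> = (\<lambda>e\<in>idempotents S m. \<xi> (m (m (star S m s) e) s))"

definition invariant_set :: "'a set \<Rightarrow> ('a \<Rightarrow> 'a \<Rightarrow> 'a) \<Rightarrow> ('a \<Rightarrow> nat) set \<Rightarrow> bool" where
  "invariant_set S m F \<longleftrightarrow>
     (\<forall>s\<in>S. \<forall>\<xi>\<in>F. \<xi> (m (star S m s) s) = 1 \<longrightarrow> beta S m s \<xi> \<in> F)"

definition multiplicative_set :: "'a set \<Rightarrow> ('a \<Rightarrow> nat) set \<Rightarrow> bool" where
  "multiplicative_set E F \<longleftrightarrow>
     (\<forall>\<xi>\<in>F. \<forall>\<eta>\<in>F. (\<exists>e\<in>E. \<xi> e * \<eta> e \<noteq> 0) \<longrightarrow> (\<lambda>e\<in>E. \<xi> e * \<eta> e) \<in> F)"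

definition congruence_characters ::
    "'a set \<Rightarrow> ('a \<Rightarrow> 'a \<Rightarrow> 'a) \<Rightarrow> ('a \<times> 'a) set \<Rightarrow> ('a \<Rightarrow> nat) set" where
  "congruence_characters E m \<rho> =
     (\<lambda>\<eta>. compose E \<eta> (\<lambda>e. \<rho> `` {e})) ` characters (E // \<rho>) (quotient_mult m \<rho>)"

end

theory Submission
  imports Defs "HOL-Analysis.Abstract_Topological_Spaces"
begin

text \<open>A character of \<open>E\<close> factors through \<open>E // \<rho>\<close> exactly when it is constant on \<open>\<rho>\<close>-classes, so \<open>F\<close>
  is cut out of the characters by the equations \<open>\<xi> e = \<xi> f\<close> for \<open>(e, f) \<in> \<rho>\<close>. These are closed
  conditions and are preserved by pointwise products; normality of \<open>\<rho>\<close>, applied to \<open>s\<^sup>*\<close>, shows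
  that they are preserved by \<open>\<beta>\<^sub>s\<close>.\<close>

context
  fixes S :: "'a set" and m :: "'a \<Rightarrow> 'a \<Rightarrow> 'a" (infixl "\<cdot>" 70)
  assumes inv_sgp: "inverse_semigroup S (\<cdot>)"
begin

private abbreviation inv_elem :: "'a \<Rightarrow> 'a" where
  "inv_elem \<equiv> star S (\<cdot>)"

section \<open>Inverses and the commutative semigroup of idempotents\<close>

lemma mult_closed: "a \<in> S \<Longrightarrow> b \<in> S \<Longrightarrow> a \<cdot> b \<in> S"
  using inv_sgp unfolding inverse_semigroup_def by blast

lemma mult_assoc: "a \<in> S \<Longrightarrow> b \<in> S \<Longrightarrow> c \<in> S \<Longrightarrow> (a \<cdot> b) \<cdot> c = a \<cdot> (b \<cdot> c)"
  using inv_sgp unfolding inverse_semigroup_def by blast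

lemma inverse_ex1: "s \<in> S \<Longrightarrow> \<exists>!t. t \<in> S \<and> s = s \<cdot> t \<cdot> s \<and> t = t \<cdot> s \<cdot> t"
  using inv_sgp unfolding inverse_semigroup_def by blast

lemma
  assumes "s \<in> S"
  shows star_closed: "inv_elem s \<in> S"
    and mult_star_mult: "s \<cdot> inv_elem s \<cdot> s = s"
    and star_mult_star: "inv_elem s \<cdot> s \<cdot> inv_elem s = inv_elem s"
  using theI'[OF inverse_ex1[OF assms]] unfolding star_def by auto

lemma star_eqI:
  assumes "s \<in> S" "t \<in> S" "s \<cdot> t \<cdot> s = s" "t \<cdot> s \<cdot> t = t"
  shows "inv_elem s = t"
  unfolding star_def using the1_equality[OF inverse_ex1[OF assms(1)]] assms by simp

lemma star_star: "s \<in> S \<Longrightarrow> inv_elem (inv_elem s) = s"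
  by (simp add: star_eqI star_closed mult_star_mult star_mult_star)

lemma idempotents_memD:
  assumes "e \<in> idempotents S (\<cdot>)"
  shows "e \<in> S" "e \<cdot> e = e"
  using assms by (auto simp: idempotents_def)

text \<open>Idempotency as a rewrite rule for right-nested products, where
  \<open>e \<cdot> e\<close> itself does not occur as a subterm once another factor follows.\<close>

lemma idempotent_absorb:
  assumes "e \<in> idempotents S (\<cdot>)" "a \<in> S"
  shows "e \<cdot> (e \<cdot> a) = e \<cdot> a"
  using assms by (metis idempotents_memD mult_assoc)

lemma star_idempotent: "e \<in> idempotents S (\<cdot>) \<Longrightarrow> inv_elem e = e"
  by (simp add: star_eqI idempotents_memD)

text \<open>With \<open>x = (e \<cdot> f)\<^sup>*\<close>, the element \<open>f \<cdot> x \<cdot> e\<close> is idempotent and also an inverse of \<open>e \<cdot> f\<close>; hence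
  \<open>x\<close> is idempotent, and so is its inverse \<open>e \<cdot> f = x\<^sup>* = x\<close>.\<close>

lemma idempotents_mult_closed:
  assumes e: "e \<in> idempotents S (\<cdot>)" and f: "f \<in> idempotents S (\<cdot>)"
  shows "e \<cdot> f \<in> idempotents S (\<cdot>)"
proof -
  note S = idempotents_memD(1)[OF e] idempotents_memD(1)[OF f]
  define x where "x = inv_elem (e \<cdot> f)"
  have xS: "x \<in> S" by (simp add: x_def star_closed mult_closed S)
  note assoc = mult_assoc mult_closed S xS idempotent_absorb e f
  have "(e \<cdot> f) \<cdot> x \<cdot> (e \<cdot> f) = e \<cdot> f" and xefx: "x \<cdot> (e \<cdot> f) \<cdot> x = x"
    by (simp_all add: x_def mult_star_mult star_mult_star mult_closed S)
  then have efx: "e \<cdot> (f \<cdot> (x \<cdot> (e \<cdot> f))) = e \<cdot> f" by (simp add: assoc)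
  \<comment> \<open>The identity \<open>xefx\<close> with a trailing factor \<open>b\<close>, nested
    to the right so that it can rewrite inside longer products.\<close>
  have cancel: "x \<cdot> (e \<cdot> (f \<cdot> (x \<cdot> b))) = x \<cdot> b" if "b \<in> S" for b
    using arg_cong[OF xefx, of "\<lambda>y. y \<cdot> b"] that by (simp add: assoc)
  have "x = f \<cdot> x \<cdot> e"
    unfolding x_def
    by (rule star_eqI) (simp_all add: assoc efx cancel flip: x_def)
  moreover have "f \<cdot> x \<cdot> e \<cdot> (f \<cdot> x \<cdot> e) = f \<cdot> x \<cdot> e"
    by (simp add: assoc cancel)
  ultimately have "x \<in> idempotents S (\<cdot>)"
    using xS by (simp add: idempotents_def)
  moreover have "inv_elem x = e \<cdot> f"
    by (simp add: x_def star_star mult_closed S)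
  ultimately show ?thesis
    using star_idempotent by auto
qed

text \<open>Both \<open>e \<cdot> f\<close> and \<open>f \<cdot> e\<close> are idempotent. This
  makes \<open>f \<cdot> e\<close> an inverse of \<open>e \<cdot> f\<close>, but an idempotent is
  its own inverse, so uniqueness of inverses identifies the two.\<close>

lemma idempotents_commute:
  assumes e: "e \<in> idempotents S (\<cdot>)" and f: "f \<in> idempotents S (\<cdot>)"
  shows "e \<cdot> f = f \<cdot> e"
proof -
  note S = idempotents_memD(1)[OF e] idempotents_memD(1)[OF f]
  note assoc = mult_assoc mult_closed S idempotent_absorb e f
  have "e \<cdot> (f \<cdot> (e \<cdot> f)) = e \<cdot> f" "f \<cdot> (e \<cdot> (f \<cdot> e)) = f \<cdot> e"
    using idempotents_memD(2)[OF idempotents_mult_closed[OF e f]]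
      idempotents_memD(2)[OF idempotents_mult_closed[OF f e]] by (simp_all add: assoc)
  then have "inv_elem (e \<cdot> f) = f \<cdot> e"
    by (intro star_eqI) (simp_all add: assoc)
  then show ?thesis
    using star_idempotent[OF idempotents_mult_closed[OF e f]] by simp
qed

section \<open>Conjugation of idempotents and the maps \<open>beta\<close>\<close>

lemma mult_star_idempotent: "s \<in> S \<Longrightarrow> s \<cdot> inv_elem s \<in> idempotents S (\<cdot>)"
  by (simp add: idempotents_def mult_closed star_closed mult_star_mult flip: mult_assoc)

text \<open>The inner factor \<open>s \<cdot> inv_elem s\<close> is idempotent, so it commutes past
  \<open>e\<close> and is absorbed by \<open>inv_elem s\<close> on the left. This gives
  multiplicativity of \<open>beta\<close> and, for \<open>e = f\<close>, idempotency of
  conjugates.\<close>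

lemma conjugate_mult:
  assumes s: "s \<in> S" and e: "e \<in> idempotents S (\<cdot>)" and f: "f \<in> idempotents S (\<cdot>)"
  shows "(inv_elem s \<cdot> e \<cdot> s) \<cdot> (inv_elem s \<cdot> f \<cdot> s) = inv_elem s \<cdot> (e \<cdot> f) \<cdot> s"
proof -
  note S = s star_closed[OF s] idempotents_memD(1)[OF e] idempotents_memD(1)[OF f]
  note assoc = mult_assoc mult_closed S
  have "(inv_elem s \<cdot> e \<cdot> s) \<cdot> (inv_elem s \<cdot> f \<cdot> s) = inv_elem s \<cdot> (e \<cdot> (s \<cdot> inv_elem s)) \<cdot> (f \<cdot> s)"
    by (simp add: assoc)
  also have "\<dots> = (inv_elem s \<cdot> s \<cdot> inv_elem s) \<cdot> e \<cdot> (f \<cdot> s)"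
    by (simp add: idempotents_commute[OF e mult_star_idempotent[OF s]]) (simp add: assoc)
  also have "\<dots> = inv_elem s \<cdot> (e \<cdot> f) \<cdot> s"
    by (simp add: star_mult_star s) (simp add: assoc)
  finally show ?thesis .
qed

lemma conjugate_idempotent:
  assumes s: "s \<in> S" and e: "e \<in> idempotents S (\<cdot>)"
  shows "inv_elem s \<cdot> e \<cdot> s \<in> idempotents S (\<cdot>)"
  using conjugate_mult[OF s e e] s e idempotents_memD[OF e]
  by (simp add: idempotents_def mult_closed star_closed)

lemma beta_character:
  assumes s: "s \<in> S" and \<xi>: "\<xi> \<in> characters (idempotents S (\<cdot>)) (\<cdot>)"
    and one: "\<xi> (inv_elem s \<cdot> s) = 1"
  shows "beta S (\<cdot>) s \<xi> \<in> characters (idempotents S (\<cdot>)) (\<cdot>)"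
proof -
  let ?E = "idempotents S (\<cdot>)"
  have "beta S (\<cdot>) s \<xi> \<in> ?E \<rightarrow>\<^sub>E {0, 1}"
    using \<xi> conjugate_idempotent[OF s] unfolding beta_def characters_def
    by (auto simp: PiE_iff)
  moreover have "beta S (\<cdot>) s \<xi> (e \<cdot> f) = beta S (\<cdot>) s \<xi> e * beta S (\<cdot>) s \<xi> f"
    if "e \<in> ?E" "f \<in> ?E" for e f
    using \<xi> that conjugate_idempotent[OF s] idempotents_mult_closed
    by (simp add: beta_def characters_def flip: conjugate_mult[OF s])
  \<comment> \<open>The witness for being nonzero: conjugation sends
    \<open>s \<cdot> inv_elem s\<close> to \<open>inv_elem s \<cdot> s\<close>, where \<xi> is 1 by
    \<open>one\<close>.\<close>
  moreover have "beta S (\<cdot>) s \<xi> (s \<cdot> inv_elem s) = 1"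
    using one s mult_star_idempotent[OF s]
    by (simp add: beta_def star_mult_star mult_closed star_closed flip: mult_assoc)
  ultimately show ?thesis
    using mult_star_idempotent[OF s] unfolding characters_def by force
qed

text \<open>Normality conjugates with the inverse on the right, \<open>beta\<close> with the inverse
  on the left; since \<open>star_star\<close> holds, replacing \<open>s\<close> by its inverse
  passes from one to the other.\<close>

lemma normal_congruence_conjugate:
  assumes "normal_congruence S (\<cdot>) \<rho>" "s \<in> S" "(e, f) \<in> \<rho>"
  shows "(inv_elem s \<cdot> e \<cdot> s, inv_elem s \<cdot> f \<cdot> s) \<in> \<rho>"
  using assms star_closed[OF assms(2)] star_star[OF assms(2)]
  unfolding normal_congruence_def by metis

end

section \<open>Characters of the quotient\<close>

lemma quotient_mult_class:
  assumes \<rho>: "semigroup_congruence E m \<rho>" and e: "e \<in> E" and f: "f \<in> E"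
  shows "quotient_mult m \<rho> (\<rho> `` {e}) (\<rho> `` {f}) = \<rho> `` {m e f}"
proof -
  have equiv: "equiv E \<rho>" using \<rho> by (simp add: semigroup_congruence_def)
  \<comment> \<open>All classes in the union coincide: change the first factor from \<open>e\<close>
    to \<open>a\<close>, then the second from \<open>f\<close> to \<open>b\<close>.\<close>
  have "\<rho> `` {m a b} = \<rho> `` {m e f}" if "(e, a) \<in> \<rho>" "(f, b) \<in> \<rho>" for a b
  proof -
    have "a \<in> E" using equiv that by (auto dest: equivE simp: refl_on_def equiv_def)
    then have "(m e f, m a f) \<in> \<rho>" "(m a f, m a b) \<in> \<rho>"
      using \<rho> that f by (auto simp: semigroup_congruence_def)
    then show ?thesis using equiv_class_eq[OF equiv] by metis
  qed
  \<comment> \<open>Both index classes are nonempty, so the union is the common class and not the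
    empty set.\<close>
  moreover have "(e, e) \<in> \<rho>" "(f, f) \<in> \<rho>"
    using equiv e f by (auto elim!: equivE simp: refl_on_def)
  ultimately show ?thesis unfolding quotient_mult_def by blast
qed

lemma congruence_characters_eq:
  assumes \<rho>: "semigroup_congruence E m \<rho>"
    and closed: "\<And>e f. e \<in> E \<Longrightarrow> f \<in> E \<Longrightarrow> m e f \<in> E"
  shows "congruence_characters E m \<rho> = {\<xi> \<in> characters E m. \<forall>(e, f) \<in> \<rho>. \<xi> e = \<xi> f}"
    (is "?L = ?R")
proof
  have equiv: "equiv E \<rho>" using \<rho> by (simp add: semigroup_congruence_def)
  have \<rho>E: "e \<in> E" "f \<in> E" if "(e, f) \<in> \<rho>" for e f
    using equiv that by (auto simp: equiv_def)
  show "?L \<subseteq> ?R"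
  proof
    fix \<xi> assume "\<xi> \<in> ?L"
    then obtain \<eta> where \<eta>: "\<eta> \<in> characters (E // \<rho>) (quotient_mult m \<rho>)"
      and \<xi>: "\<xi> = compose E \<eta> (\<lambda>e. \<rho> `` {e})"
      unfolding congruence_characters_def by blast
    have \<xi>_eq: "\<xi> e = \<eta> (\<rho> `` {e})" if "e \<in> E" for e
      using that by (simp add: \<xi> compose_def)
    have "\<xi> \<in> E \<rightarrow>\<^sub>E {0, 1}"
      using \<eta> by (auto simp: \<xi> compose_def characters_def PiE_iff quotientI)
    moreover have "\<xi> (m e f) = \<xi> e * \<xi> f" if "e \<in> E" "f \<in> E" for e f
      using \<eta> that closed
      by (simp add: \<xi>_eq characters_def quotientI flip: quotient_mult_class[OF \<rho>])
    \<comment> \<open>A class on which \<eta> is nonzero has a representative in \<open>E\<close>,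
      and \<xi> is nonzero there.\<close>
    moreover have "\<exists>e\<in>E. \<xi> e \<noteq> 0"
      using \<eta> \<xi>_eq unfolding characters_def by (force elim!: quotientE)
    moreover have "\<xi> e = \<xi> f" if "(e, f) \<in> \<rho>" for e f
      using \<rho>E[OF that] equiv_class_eq[OF equiv that] by (simp add: \<xi>_eq)
    ultimately show "\<xi> \<in> ?R" by (auto simp: characters_def)
  qed
  show "?R \<subseteq> ?L"
  proof
    fix \<xi> assume "\<xi> \<in> ?R"
    then have \<xi>: "\<xi> \<in> characters E m" and const: "\<And>e f. (e, f) \<in> \<rho> \<Longrightarrow> \<xi> e = \<xi> f" by auto
    \<comment> \<open>The descended character: \<xi> maps each class to a singleton, whose element
      \<open>the_elem\<close> extracts. The restriction makes \<eta> extensional, as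
      \<open>characters\<close> demands.\<close>
    define \<eta> where "\<eta> = (\<lambda>c\<in>E // \<rho>. the_elem (\<xi> ` c))"
    have \<eta>_class: "\<eta> (\<rho> `` {e}) = \<xi> e" if "e \<in> E" for e
    proof -
      have "\<xi> ` (\<rho> `` {e}) = {\<xi> e}"
        by (intro equalityI subsetI) (auto dest: const[symmetric] intro!: imageI[OF equiv_class_self[OF equiv that]])
      then show ?thesis using that by (simp add: \<eta>_def quotientI)
    qed
    have "\<eta> \<in> E // \<rho> \<rightarrow>\<^sub>E {0, 1}"
    proof (rule PiE_I)
      fix c assume "c \<in> E // \<rho>"
      then show "\<eta> c \<in> {0, 1}"
        using \<xi> \<eta>_class by (elim quotientE) (auto simp: characters_def PiE_iff)
    qed (simp add: \<eta>_def)
    moreover have "\<eta> (quotient_mult m \<rho> c d) = \<eta> c * \<eta> d" if "c \<in> E // \<rho>" "d \<in> E // \<rho>" for c d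
      using that \<xi> closed
      by (elim quotientE) (simp add: \<eta>_class quotient_mult_class[OF \<rho>] characters_def)
    moreover have "\<exists>c\<in>E // \<rho>. \<eta> c \<noteq> 0"
      using \<xi> \<eta>_class by (auto simp: characters_def intro!: bexI quotientI)
    ultimately have "\<eta> \<in> characters (E // \<rho>) (quotient_mult m \<rho>)"
      by (simp add: characters_def)
    moreover have "\<xi> = compose E \<eta> (\<lambda>e. \<rho> `` {e})"
      using \<xi> \<eta>_class by (auto simp: compose_def characters_def PiE_iff extensional_def)
    ultimately show "\<xi> \<in> ?L" unfolding congruence_characters_def by blast
  qed
qed

section \<open>Closedness and pointwise products\<close>

lemma topspace_character_topology: "topspace (character_topology E m) = characters E m"
  by (auto simp: character_topology_def characters_def)

text \<open>Evaluation at a point of \<open>E\<close> is continuous into a discrete, hence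
  Hausdorff, space. The set where two evaluations agree is therefore closed, and an intersection of
  such sets remains closed.\<close>

lemma closedin_characters_constant_on:
  assumes "\<rho> \<subseteq> E \<times> E"
  shows "closedin (character_topology E m) {\<xi> \<in> characters E m. \<forall>(e, f) \<in> \<rho>. \<xi> e = \<xi> f}"
proof -
  let ?X = "character_topology E m"
  have "continuous_map ?X (discrete_topology {0, 1}) (\<lambda>\<xi>. \<xi> e)" if "e \<in> E" for e
    unfolding character_topology_def
    using that by (intro continuous_map_from_subtopology continuous_map_product_projection)
  then have "closedin ?X {\<xi> \<in> topspace ?X. \<xi> e = \<xi> f}" if "(e, f) \<in> \<rho>" for e f
    using that assms
    by (intro closedin_continuous_maps_eq[where Y = "discrete_topology {0, 1}"]) auto
  \<comment> \<open>Inserting the whole space keeps the family nonempty even for empty \<rho>, when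
    the bare intersection would be \<open>UNIV\<close>.\<close>
  then have "closedin ?X (\<Inter>(insert (topspace ?X) ((\<lambda>(e, f). {\<xi> \<in> topspace ?X. \<xi> e = \<xi> f}) ` \<rho>)))"
    by (intro closedin_Inter) auto
  also have "\<Inter>(insert (topspace ?X) ((\<lambda>(e, f). {\<xi> \<in> topspace ?X. \<xi> e = \<xi> f}) ` \<rho>)) =
      {\<xi> \<in> characters E m. \<forall>(e, f) \<in> \<rho>. \<xi> e = \<xi> f}"
    by (auto simp: topspace_character_topology)
  finally show ?thesis .
qed

lemma characters_times:
  assumes "\<xi> \<in> characters E m" "\<eta> \<in> characters E m" "\<exists>e\<in>E. \<xi> e * \<eta> e \<noteq> 0"
    and "\<And>e f. e \<in> E \<Longrightarrow> f \<in> E \<Longrightarrow> m e f \<in> E"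
  shows "(\<lambda>e\<in>E. \<xi> e * \<eta> e) \<in> characters E m"
proof -
  have vals: "\<xi> e \<in> {0, 1}" "\<eta> e \<in> {0, 1}" if "e \<in> E" for e
    using assms(1,2) that by (auto simp: characters_def PiE_iff)
  have "(\<lambda>e\<in>E. \<xi> e * \<eta> e) \<in> E \<rightarrow>\<^sub>E {0, 1}"
    using vals by fastforce
  moreover have "\<xi> (m e f) = \<xi> e * \<xi> f" "\<eta> (m e f) = \<eta> e * \<eta> f" if "e \<in> E" "f \<in> E" for e f
    using assms(1,2) that by (auto simp: characters_def)
  ultimately show ?thesis
    using assms(3,4) by (simp add: characters_def ac_simps)
qed

theorem proposition3p1p2:
  fixes S :: "'a set" and m :: "'a \<Rightarrow> 'a \<Rightarrow> 'a" and \<rho> :: "('a \<times> 'a) set"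
  assumes "inverse_semigroup S m"
    and "normal_congruence S m \<rho>"
  defines "E \<equiv> idempotents S m"
  defines "F \<equiv> congruence_characters E m \<rho>"
  shows "F \<subseteq> characters E m \<and> closedin (character_topology E m) F \<and>
    multiplicative_set E F \<and> invariant_set S m F"
proof -
  have \<rho>: "semigroup_congruence E m \<rho>"
    using assms(2) by (simp add: normal_congruence_def E_def)
  then have \<rho>E: "\<rho> \<subseteq> E \<times> E"
    by (auto simp: semigroup_congruence_def equiv_def)
  have closed: "\<And>e f. e \<in> E \<Longrightarrow> f \<in> E \<Longrightarrow> m e f \<in> E"
    unfolding E_def by (rule idempotents_mult_closed[OF assms(1)])
  have F: "F = {\<xi> \<in> characters E m. \<forall>(e, f) \<in> \<rho>. \<xi> e = \<xi> f}"
    unfolding F_def using \<rho> closed by (rule congruence_characters_eq)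
  have "multiplicative_set E F"
    unfolding multiplicative_set_def
  proof (intro ballI impI)
    fix \<xi> \<eta> assume "\<xi> \<in> F" "\<eta> \<in> F" "\<exists>e\<in>E. \<xi> e * \<eta> e \<noteq> 0"
    then have "(\<lambda>e\<in>E. \<xi> e * \<eta> e) \<in> characters E m"
      using closed by (intro characters_times) (auto simp: F)
    \<comment> \<open>Membership of \<open>e\<close> and \<open>f\<close> in \<open>E\<close> is
      recorded because the restricted product has the value \<open>\<xi> e * \<eta> e\<close> only
      on \<open>E\<close>.\<close>
    moreover have "\<xi> e = \<xi> f" "\<eta> e = \<eta> f" "e \<in> E" "f \<in> E" if "(e, f) \<in> \<rho>" for e f
      using \<open>\<xi> \<in> F\<close> \<open>\<eta> \<in> F\<close> \<rho>E that by (auto simp: F)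
    ultimately show "(\<lambda>e\<in>E. \<xi> e * \<eta> e) \<in> F"
      by (auto simp: F)
  qed
  moreover have "invariant_set S m F"
    unfolding invariant_set_def
  proof (intro ballI impI)
    fix s \<xi> assume s: "s \<in> S" and \<xi>: "\<xi> \<in> F" and one: "\<xi> (m (star S m s) s) = 1"
    have "beta S m s \<xi> \<in> characters E m"
      using beta_character[OF assms(1) s] \<xi> one by (simp add: F E_def)
    moreover have "beta S m s \<xi> e = beta S m s \<xi> f" if "(e, f) \<in> \<rho>" for e f
    proof -
      \<comment> \<open>The two conjugates are again related by \<rho>, and \<xi> is constant on
        classes.\<close>
      have "\<xi> (m (m (star S m s) e) s) = \<xi> (m (m (star S m s) f) s)"
        using normal_congruence_conjugate[OF assms(1,2) s that] \<xi> by (auto simp: F)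
      then show ?thesis using \<rho>E that by (auto simp: beta_def E_def)
    qed
    ultimately show "beta S m s \<xi> \<in> F" by (auto simp: F)
  qed
  ultimately show ?thesis
    using closedin_characters_constant_on[OF \<rho>E] by (auto simp: F)
qed

end
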